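(* Let $0<n_1\le\dots\le n_m$, $\bar n=(n_1,\dots,n_m)$, $n=n_m$, let $\lambda$ be a partition with $l(\lambda)\le \#\mathrm{St}_{\bar n}$. For any two $DL$-dense arrays $A,B\in \mathrm{DL}_{\bar n}(\lambda)$, $$\mathrm{hor}(A)\prec\mathrm{hor}(B)\ \text{ in the Bruhat order on }\mathbb S_n\lambda\quad\Longleftrightarrow\quad \mathrm{vrt}(A)\prec\mathrm{vrt}(B)\ \text{ in the Bruhat order on }\mathbb S_m\lambda.$$ In other words, the horizontal and vertical Bruhat orders on $\mathrm{DL}_{\bar n}(\lambda)$ coincide.
   Context: $Y_{\bar n}=\{(i,j):1\le j\le m,\ 1\le i\le n_j\}$ ($i$ = row, $j$ = column). Staircase corners: $\mathrm{St}_{\bar n}\subset Y_{\bar n}$ is the set with at most one cell in each row and column, containing every cell $(n_j,j)$ with $n_j>n_{j-1}$ ($n_0=0$), and such that for each $(i,j)\in \mathrm{St}_{\bar n}$ the remaining elements are exactly the staircase corners of the diagram obtained by deleting row $i$ and column $j$. Concretely: process the columns $j=1,\dots,m$ in order; in column $j$ choose the largest $i\le n_j$ such that row $i$ contains no previously chosen cell (choose nothing if there is none). Partial order: $(i,j)\succeq(i',j')$ iff $i\ge i'$ and $j\le j'$. $\mathrm{DL}_{\bar n}(\lambda)$ is the set of functions $A:Y_{\bar n}\to\mathbb Z_{\ge0}$ vanishing outside $\mathrm{St}_{\bar n}$, with $A_s\le A_t$ whenever $s\prec t$ in $\mathrm{St}_{\bar n}$, whose multiset of nonzero values is the multiset of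 parts of $\lambda$. $\mathrm{hor}(A)\in\mathbb Z^n$ and $\mathrm{vrt}(A)\in\mathbb Z^m$ are the vectors of row sums and of column sums. Partitions are padded by zeros. The Bruhat order on $\mathbb S_m\lambda$ is the reflexive transitive closure of $a\prec(ij)a$ whenever $i<j$, $a_i>a_j$, where $(ij)a$ exchanges the $i$-th and $j$-th entries (the strong Bruhat order on $\mathbb S_m/\mathrm{Stab}(\lambda)$ with minimum the partition $\lambda$); similarly for $\mathbb S_n\lambda$. *)

theory Defs
  imports "HOL-Combinatorics.Permutations"
begin

text \<open>
  The sequence of column lengths is a function on the indices \<open>1, \<dots>, m\<close>; its values
  at other arguments are irrelevant. A cell is a pair (row, column), counted from 1.
\<close>

definition diagram :: "(nat \<Rightarrow> nat) \<Rightarrow> nat \<Rightarrow> (nat \<times> nat) set" where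
  "diagram ns m = {(i, j). 1 \<le> j \<and> j \<le> m \<and> 1 \<le> i \<and> i \<le> ns j}"

text \<open>
  Columns are processed from left to right; each one receives its cell of largest row index among the rows
  that do not yet contain a chosen cell, if there is such a cell.
\<close>

primrec staircase :: "(nat \<Rightarrow> nat) \<Rightarrow> nat \<Rightarrow> (nat \<times> nat) set" where
  "staircase ns 0 = {}"
| "staircase ns (Suc k) =
    (let free = {i. 1 \<le> i \<and> i \<le> ns (Suc k) \<and> i \<notin> fst ` staircase ns k}
     in if free = {} then staircase ns k
        else insert (Max free, Suc k) (staircase ns k))"

definition cell_le :: "nat \<times> nat \<Rightarrow> nat \<times> nat \<Rightarrow> bool" where
  "cell_le s t \<longleftrightarrow> fst s \<le> fst t \<and> snd t \<le> snd s"

definition cell_less :: "nat \<times> nat \<Rightarrow> nat \<times> nat \<Rightarrow> bool" where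
  "cell_less s t \<longleftrightarrow> cell_le s t \<and> s \<noteq> t"

definition is_partition :: "nat list \<Rightarrow> bool" where
  "is_partition lam \<longleftrightarrow> sorted_wrt (\<ge>) lam \<and> 0 \<notin> set lam"

text \<open>
  Arrays on the diagram are represented by their extension by zero to all pairs.
\<close>

definition DL :: "(nat \<Rightarrow> nat) \<Rightarrow> nat \<Rightarrow> nat list \<Rightarrow> (nat \<times> nat \<Rightarrow> nat) set" where
  "DL ns m lam = {A.
     (\<forall>s. s \<notin> staircase ns m \<longrightarrow> A s = 0) \<and>
     (\<forall>s\<in>staircase ns m. \<forall>t\<in>staircase ns m. cell_less s t \<longrightarrow> A s \<le> A t) \<and>
     filter_mset (\<lambda>x. x \<noteq> 0) (image_mset A (mset_set (diagram ns m))) = mset lam}"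

text \<open>
  Integer vectors of length \<open>k\<close> are lists of length \<open>k\<close>, so the entry of index \<open>i\<close>
  is stored at list position \<open>i - 1\<close>.
\<close>

definition hor :: "(nat \<Rightarrow> nat) \<Rightarrow> nat \<Rightarrow> (nat \<times> nat \<Rightarrow> nat) \<Rightarrow> int list" where
  "hor ns m A = map (\<lambda>i. \<Sum>j | (i, j) \<in> diagram ns m. int (A (i, j))) [1..<Suc (ns m)]"

definition vrt :: "(nat \<Rightarrow> nat) \<Rightarrow> nat \<Rightarrow> (nat \<times> nat \<Rightarrow> nat) \<Rightarrow> int list" where
  "vrt ns m A = map (\<lambda>j. \<Sum>i | (i, j) \<in> diagram ns m. int (A (i, j))) [1..<Suc m]"

definition pad :: "nat \<Rightarrow> nat list \<Rightarrow> int list" where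
  "pad k lam = map int lam @ replicate (k - length lam) 0"

definition sym_orbit :: "nat \<Rightarrow> nat list \<Rightarrow> int list set" where
  "sym_orbit k lam = {permute_list p (pad k lam) | p. p permutes {..<k}}"

text \<open>
  A step exchanges two entries that are in strictly decreasing order, so the partition
  itself is the minimum of its orbit.
\<close>

definition bruhat_step :: "int list \<Rightarrow> int list \<Rightarrow> bool" where
  "bruhat_step a b \<longleftrightarrow>
     (\<exists>i j. i < j \<and> j < length a \<and> a ! i > a ! j \<and> b = a[i := a ! j, j := a ! i])"

definition bruhat :: "nat \<Rightarrow> nat list \<Rightarrow> int list \<Rightarrow> int list \<Rightarrow> bool" where
  "bruhat k lam a b \<longleftrightarrow>
     a \<in> sym_orbit k lam \<and> b \<in> sym_orbit k lam \<and> bruhat_step\<^sup>*\<^sup>* a b"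

end

theory Submission
  imports Defs
begin

text \<open>
  Read rows as opening and columns as closing brackets, column \<open>j\<close> closing after the opening
  of row \<open>ns j\<close>. The staircase is then the bracket matching, a system of noncrossing arcs, and
  \<open>cell_less s t\<close> says that the arc \<open>t\<close> is nested in the arc \<open>s\<close>.
  For each threshold \<open>v > 0\<close> the cells with entry at least \<open>v\<close> form a set of arcs closed under
  passing to nested arcs. By the prefix-count criterion, the Bruhat order compares, for all
  thresholds, how many of these arcs have their left (horizontal order) or right (vertical order)
  endpoint in an initial segment. The difference of the two counts is the number of arcs that
  span the end of the segment. If one order holds and the other fails, comparing these numbers
  gives a spanning arc in one closed set and not in the other; closure under nesting then
  propagates the failure to an end of the word, where there is none.
\<close>

section \<open>The prefix-count criterion for the Bruhat order\<close>

definition count_ge :: "int \<Rightarrow> int list \<Rightarrow> nat" where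
  "count_ge v xs = length (filter (\<lambda>x. v \<le> x) xs)"

lemma count_ge_simps [simp]:
  "count_ge v [] = 0"
  "count_ge v (x # xs) = (if v \<le> x then Suc (count_ge v xs) else count_ge v xs)"
  "count_ge v (xs @ ys) = count_ge v xs + count_ge v ys"
  by (simp_all add: count_ge_def)

lemma count_ge_mono: "v \<le> w \<Longrightarrow> count_ge w xs \<le> count_ge v xs"
  by (induction xs) auto

text \<open>The tableau criterion for the Bruhat order: since the partition is the minimum, the
  smaller vector has its large entries earlier.\<close>

definition prefix_dominates :: "int list \<Rightarrow> int list \<Rightarrow> bool" where
  "prefix_dominates a b \<longleftrightarrow> (\<forall>p v. count_ge v (take p b) \<le> count_ge v (take p a))"

lemma bruhat_step_swap:
  assumes "d < c"
  shows "bruhat_step (xs @ c # ys @ d # zs) (xs @ d # ys @ c # zs)"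
  unfolding bruhat_step_def
  by (rule exI[of _ "length xs"], rule exI[of _ "Suc (length xs + length ys)"])
     (use assms in \<open>simp add: nth_append list_update_append\<close>)

lemma bruhat_stepE:
  assumes "bruhat_step a b"
  obtains xs c ys d zs where "d < c" "a = xs @ c # ys @ d # zs" "b = xs @ d # ys @ c # zs"
proof -
  obtain i j where ij: "i < j" "j < length a" "a ! j < a ! i" "b = a[i := a ! j, j := a ! i]"
    using assms unfolding bruhat_step_def by auto
  define xs ys zs where "xs = take i a" and "ys = take (j - Suc i) (drop (Suc i) a)"
    and "zs = drop (Suc j) a"
  have "drop (Suc i) a = ys @ a ! j # zs"
    using id_take_nth_drop[of "j - Suc i" "drop (Suc i) a"] ij by (simp add: ys_def zs_def)
  moreover have "a = xs @ a ! i # drop (Suc i) a"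
    using id_take_nth_drop[of i a] ij by (simp add: xs_def)
  ultimately have a: "a = xs @ a ! i # ys @ a ! j # zs" by simp
  have len: "length xs = i" "length ys = j - Suc i"
    using ij by (auto simp: xs_def ys_def)
  then have j: "j = Suc (i + length ys)" using ij(1) by simp
  have "(xs @ c # ys @ d # zs)[i := d, j := c] = xs @ d # ys @ c # zs" for c d
    unfolding j by (simp add: list_update_append len(1)[symmetric])
  then have "b = xs @ a ! j # ys @ a ! i # zs"
    using ij(4) a by metis
  then show thesis using that[OF ij(3) a] by simp
qed

text \<open>Only prefixes that end between the two exchanged positions change: they contain
  \<open>d\<close> in place of the larger \<open>c\<close>, so no count grows.\<close>

lemma bruhat_step_imp_prefix_dominates:
  assumes "bruhat_step a b"
  shows "prefix_dominates a b"
proof -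
  obtain xs c ys d zs where *: "d < c" "a = xs @ c # ys @ d # zs" "b = xs @ d # ys @ c # zs"
    using assms by (rule bruhat_stepE)
  show ?thesis unfolding prefix_dominates_def * using \<open>d < c\<close>
    by (auto simp: take_Cons split: nat.split)
qed

lemma bruhat_step_Cons: "bruhat_step a b \<Longrightarrow> bruhat_step (x # a) (x # b)"
  by (erule bruhat_stepE) (metis append_Cons bruhat_step_swap)

lemma bruhat_steps_Cons: "bruhat_step\<^sup>*\<^sup>* a b \<Longrightarrow> bruhat_step\<^sup>*\<^sup>* (x # a) (x # b)"
  by (induction rule: rtranclp_induct) (auto intro: rtranclp.rtrancl_into_rtrancl bruhat_step_Cons)

lemma bruhat_steps_imp_prefix_dominates:
  "bruhat_step\<^sup>*\<^sup>* a b \<Longrightarrow> prefix_dominates a b"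
proof (induction rule: rtranclp_induct)
  case base
  then show ?case by (simp add: prefix_dominates_def)
next
  case (step b c)
  then show ?case
    using bruhat_step_imp_prefix_dominates[of b c] unfolding prefix_dominates_def
    by (meson order_trans)
qed

text \<open>The head of \<open>a\<close> is lowered to the head of \<open>b\<close> by exchanges
  that preserve dominance; once the heads agree, they are removed. The inner induction is on the gap
  \<open>x - y\<close>.\<close>

lemma prefix_dominates_imp_bruhat_steps:
  assumes "mset a = mset b" "prefix_dominates a b"
  shows "bruhat_step\<^sup>*\<^sup>* a b"
  using assms
proof (induction b arbitrary: a)
  case Nil
  then show ?case by simp
next
  case (Cons y b)
  have "bruhat_step\<^sup>*\<^sup>* (x # a) (y # b)"
    if "mset (x # a) = mset (y # b)" "prefix_dominates (x # a) (y # b)" for x a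
    using that
  proof (induction "nat (x - y)" arbitrary: x a rule: less_induct)
    case less
    have dom: "count_ge v (take p (y # b)) \<le> count_ge v (take p (x # a))" for p v
      using less.prems(2) by (auto simp: prefix_dominates_def)
    \<comment> \<open>At threshold \<open>y\<close> the prefix of length one of \<open>y # b\<close>
      has count 1, so \<open>x\<close> must be counted as well.\<close>
    have "y \<le> x"
      using dom[of y 1] by (simp split: if_splits)
    show ?case
    proof (cases "x = y")
      case True
      have "prefix_dominates a b"
        unfolding prefix_dominates_def
      proof (intro allI)
        fix p v
        show "count_ge v (take p b) \<le> count_ge v (take p a)"
          using dom[of v "Suc p"] True by (simp split: if_splits)
      qed
      then show ?thesis
        using Cons.IH[of a] less.prems(1) True bruhat_steps_Cons by simp
    next
      case False
      then have "y < x" using \<open>y \<le> x\<close> by simp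
      have "y \<in> set (x # a)"
        using less.prems(1) by (metis list.set_intros(1) set_mset_mset)
      then have "\<exists>z\<in>set a. y \<le> z \<and> z < x" using \<open>y < x\<close> by auto
      \<comment> \<open>The first such entry: only then does the exchange preserve dominance.\<close>
      then obtain ys z zs where a: "a = ys @ z # zs" and z: "y \<le> z" "z < x"
        and ys: "\<forall>u\<in>set ys. \<not> (y \<le> u \<and> u < x)"
        using split_list_first_prop[of a "\<lambda>z. y \<le> z \<and> z < x"] by auto
      have "prefix_dominates (z # ys @ x # zs) (y # b)"
        unfolding prefix_dominates_def
      proof (intro allI)
        fix p v
        show "count_ge v (take p (y # b)) \<le> count_ge v (take p (z # ys @ x # zs))"
        proof (cases p)
          case 0
          then show ?thesis by simp
        next
          case (Suc q)
          show ?thesis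
          \<comment> \<open>In these cases the exchange leaves the count unchanged: the prefix
            contains both positions, or both entries lie on the same side of the threshold.\<close>
          proof (cases "length ys < q \<or> v \<le> z \<or> x < v")
            case True
            then show ?thesis
              using dom[of v p] Suc a z
              by (auto simp: take_Cons split: nat.splits if_splits)
          next
            case False
            then have v: "z < v" "v \<le> x" and q: "q \<le> length ys" by auto
            \<comment> \<open>No entry of \<open>ys\<close> lies in \<open>[y, x)\<close>, and
              \<open>y <= z < v <= x\<close>, so within \<open>ys\<close> the thresholds
              \<open>v\<close> and \<open>y\<close> select the same entries. Dominance at the lower
              threshold \<open>y\<close> then suffices: there both heads are counted and
              cancel.\<close>
            have "filter (\<lambda>u. v \<le> u) (take q ys) = filter (\<lambda>u. y \<le> u) (take q ys)"
              by (rule filter_cong) (use ys v z in \<open>auto dest!: in_set_takeD\<close>)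
            then have eq: "count_ge v (take q ys) = count_ge y (take q ys)"
              by (simp add: count_ge_def)
            have "count_ge v (take q b) \<le> count_ge y (take q b)"
              by (rule count_ge_mono) (use v z in simp)
            also have "\<dots> \<le> count_ge y (take q ys)"
              using dom[of y p] Suc a q \<open>y < x\<close> by simp
            finally show ?thesis
              using Suc v z q eq by simp
          qed
        qed
      qed
      moreover have "mset (z # ys @ x # zs) = mset (y # b)"
        using less.prems(1) a by (simp add: add_mset_commute)
      ultimately have "bruhat_step\<^sup>*\<^sup>* (z # ys @ x # zs) (y # b)"
        using less.hyps[of z "ys @ x # zs"] z by simp
      moreover have "bruhat_step (x # a) (z # ys @ x # zs)"
        using bruhat_step_swap[OF z(2), of "[]" ys zs] a by simp
      ultimately show ?thesis by (rule converse_rtranclp_into_rtranclp[rotated])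
    qed
  qed
  moreover obtain x a' where "a = x # a'"
    using Cons.prems(1) by (cases a) auto
  ultimately show ?case using Cons.prems by simp
qed

section \<open>Vectors in the orbit of the padded partition\<close>

lemma in_sym_orbitI:
  assumes "length a = k" "filter_mset (\<lambda>x. x \<noteq> 0) (mset a) = image_mset int (mset lam)"
    "0 \<notin> set lam"
  shows "a \<in> sym_orbit k lam"
proof -
  have split: "mset a = image_mset int (mset lam) + filter_mset (\<lambda>x. x = 0) (mset a)"
    using multiset_partition[of "mset a" "\<lambda>x. x \<noteq> 0"] assms(2) by simp
  have zeros: "filter_mset (\<lambda>x. x = 0) (mset a) = replicate_mset (count (mset a) 0) 0"
    using filter_eq_replicate_mset[of 0 "mset a"] by simp
  \<comment> \<open>The nonzero entries account for \<open>length lam\<close> positions, so the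
    length leaves exactly the zeros added by \<open>pad\<close>.\<close>
  have "size (mset a) = length lam + count (mset a) 0"
    by (subst split, subst zeros) simp
  then have "count (mset a) 0 = k - length lam" "length lam \<le> k" using assms(1) by simp_all
  then have "mset a = mset (pad k lam)" "length (pad k lam) = k"
    using split zeros by (simp_all add: pad_def)
  then show ?thesis
    unfolding sym_orbit_def by (metis (mono_tags, lifting) mem_Collect_eq mset_eq_permutation)
qed

text \<open>The bound gives \<open>pad k lam\<close> length exactly \<open>k\<close>, so that a
  permutation of \<open>{..<k}\<close> acts on its positions.\<close>

lemma mset_eq_if_in_sym_orbit:
  "a \<in> sym_orbit k lam \<Longrightarrow> length lam \<le> k \<Longrightarrow> mset a = mset (pad k lam)"
  by (auto simp: sym_orbit_def pad_def intro!: mset_permute_list)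

lemma bruhat_iff_prefix_dominates:
  assumes "a \<in> sym_orbit k lam" "b \<in> sym_orbit k lam" "length lam \<le> k"
  shows "bruhat k lam a b \<longleftrightarrow> prefix_dominates a b"
  using assms mset_eq_if_in_sym_orbit prefix_dominates_imp_bruhat_steps
    bruhat_steps_imp_prefix_dominates
  unfolding bruhat_def by metis

section \<open>The staircase as a noncrossing matching\<close>

text \<open>Replaces \<open>Max\<close> by what the greedy choice yields: every larger row of the
  column already holds a cell.\<close>

lemma staircase_Suc_cases:
  obtains "staircase ns (Suc k) = staircase ns k"
  | l where "staircase ns (Suc k) = insert (l, Suc k) (staircase ns k)"
    "1 \<le> l" "l \<le> ns (Suc k)" "l \<notin> fst ` staircase ns k"
    "\<And>i. l < i \<Longrightarrow> i \<le> ns (Suc k) \<Longrightarrow> i \<in> fst ` staircase ns k"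
proof -
  define F where "F = {i. 1 \<le> i \<and> i \<le> ns (Suc k) \<and> i \<notin> fst ` staircase ns k}"
  have step: "staircase ns (Suc k) =
      (if F = {} then staircase ns k else insert (Max F, Suc k) (staircase ns k))"
    by (simp only: F_def Let_def staircase.simps)
  have "finite F" unfolding F_def by (rule finite_subset[of _ "{..ns (Suc k)}"]) auto
  show thesis
  proof (cases "F = {}")
    case True
    then show thesis using that(1) step by simp
  next
    case False
    have in_F: "i \<in> F \<longleftrightarrow> 1 \<le> i \<and> i \<le> ns (Suc k) \<and> i \<notin> fst ` staircase ns k" for i
      by (simp only: F_def mem_Collect_eq)
    have Max: "Max F \<in> F" using False \<open>finite F\<close> by simp
    show thesis
    proof (rule that(2)[of "Max F"])
      show "staircase ns (Suc k) = insert (Max F, Suc k) (staircase ns k)"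
        using step False by (simp only: if_False)
      show "i \<in> fst ` staircase ns k" if "Max F < i" "i \<le> ns (Suc k)" for i
        using Max_ge[OF \<open>finite F\<close>, of i] in_F[of i] that by linarith
    qed (use Max in_F[of "Max F"] in blast)+
  qed
qed

declare staircase.simps(2) [simp del]

lemma staircase_cell:
  "(i, j) \<in> staircase ns k \<Longrightarrow> 1 \<le> j \<and> j \<le> k \<and> 1 \<le> i \<and> i \<le> ns j"
proof (induction k)
  case (Suc k)
  show ?case
    by (rule staircase_Suc_cases[of ns k]) (use Suc in auto)
qed simp

lemma staircase_subset_diagram: "staircase ns m \<subseteq> diagram ns m"
  using staircase_cell by (fastforce simp: diagram_def)

lemma finite_diagram: "finite (diagram ns m)"
proof -
  have "diagram ns m = (\<Union>j\<in>{1..m}. (\<lambda>i. (i, j)) ` {1..ns j})"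
    by (auto simp: diagram_def)
  then show ?thesis by simp
qed

lemma finite_staircase: "finite (staircase ns m)"
  by (rule finite_subset[OF staircase_subset_diagram finite_diagram])

lemma inj_on_snd_staircase: "inj_on snd (staircase ns k)"
proof (induction k)
  case (Suc k)
  have "Suc k \<notin> snd ` staircase ns k"
    using staircase_cell by fastforce
  then have "inj_on snd (insert (l, Suc k) (staircase ns k))" for l
    using Suc by auto
  then show ?case
    using Suc by (rule_tac staircase_Suc_cases[of ns k]) simp_all
qed simp

lemma inj_on_fst_staircase: "inj_on fst (staircase ns k)"
proof (induction k)
  case (Suc k)
  show ?case
  proof (rule staircase_Suc_cases[of ns k])
    fix l
    assume "staircase ns (Suc k) = insert (l, Suc k) (staircase ns k)"
      and "l \<notin> fst ` staircase ns k"
    then show ?thesis using Suc by auto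
  qed (use Suc in simp)
qed simp

text \<open>Column \<open>j\<close> took its largest free row, so a larger row of that column had
  been occupied by an earlier column; cells are never removed afterwards.\<close>

lemma staircase_row_taken:
  assumes "(i, j) \<in> staircase ns k" "i < l" "l \<le> ns j"
  shows "\<exists>c<j. (l, c) \<in> staircase ns k"
  using assms
proof (induction k)
  case (Suc k)
  show ?case
  proof (cases "(i, j) \<in> staircase ns k")
    case True
    then have "\<exists>c<j. (l, c) \<in> staircase ns k" using Suc by simp
    then show ?thesis
      by (rule_tac staircase_Suc_cases[of ns k]) auto
  next
    case False
    show ?thesis
    proof (rule staircase_Suc_cases[of ns k])
      assume "staircase ns (Suc k) = staircase ns k"
      then show ?thesis using False Suc.prems(1) by simp
    next
      fix i'
      assume step: "staircase ns (Suc k) = insert (i', Suc k) (staircase ns k)"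
        and taken: "\<And>l. i' < l \<Longrightarrow> l \<le> ns (Suc k) \<Longrightarrow> l \<in> fst ` staircase ns k"
      have "i = i'" "j = Suc k" using False Suc.prems(1) step by simp_all
      then have "l \<in> fst ` staircase ns k" using taken Suc.prems by simp
      then obtain c where c: "(l, c) \<in> staircase ns k" by auto
      then have "c < j" using staircase_cell[OF c] \<open>j = Suc k\<close> by simp
      then show ?thesis using c step by auto
    qed
  qed
qed simp

text \<open>The arc of \<open>(l, r)\<close> opens before column \<open>j\<close> closes and closes
  after it, so it has to enclose the arc of \<open>(i, j)\<close>. Were \<open>l > i\<close>, row
  \<open>l\<close> would hold a cell in a column before \<open>j\<close> besides the one in column
  \<open>r\<close>.\<close>

lemma staircase_noncrossing:
  assumes "(i, j) \<in> staircase ns k" "(l, r) \<in> staircase ns k" "j < r" "l \<le> ns j"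
  shows "l \<le> i"
proof (rule ccontr)
  assume "\<not> l \<le> i"
  then obtain c where "c < j" "(l, c) \<in> staircase ns k"
    using staircase_row_taken[OF assms(1), of l] assms(4) by auto
  then show False
    using inj_onD[OF inj_on_fst_staircase, of "(l, c)" "(l, r)"] assms by auto
qed

section \<open>Row and column counts of sets closed under nesting\<close>

text \<open>For a fixed threshold, \<open>U\<close> and \<open>V\<close> will be the cells where
  \<open>A\<close> and \<open>B\<close> reach it; monotonicity of the arrays becomes closure under
  nested arcs.\<close>

locale staircase_up_sets =
  fixes ns :: "nat \<Rightarrow> nat" and m :: nat and U V :: "(nat \<times> nat) set"
  assumes ns_mono: "\<And>i j. 1 \<le> i \<Longrightarrow> i \<le> j \<Longrightarrow> j \<le> m \<Longrightarrow> ns i \<le> ns j"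
    and subset_staircase: "U \<subseteq> staircase ns m" "V \<subseteq> staircase ns m"
    and U_up: "\<And>s t. s \<in> U \<Longrightarrow> t \<in> staircase ns m \<Longrightarrow> cell_less s t \<Longrightarrow> t \<in> U"
    and V_up: "\<And>s t. s \<in> V \<Longrightarrow> t \<in> staircase ns m \<Longrightarrow> cell_less s t \<Longrightarrow> t \<in> V"
begin

lemma finite_up_sets: "finite U" "finite V"
  using subset_staircase finite_staircase finite_subset by blast+

lemma cells:
  assumes "(i, j) \<in> U \<union> V"
  shows "(i, j) \<in> staircase ns m" "1 \<le> j" "j \<le> m" "1 \<le> i" "i \<le> ns j" "i \<le> ns m"
proof -
  show st: "(i, j) \<in> staircase ns m" using assms subset_staircase by auto
  show "1 \<le> j" "j \<le> m" "1 \<le> i" "i \<le> ns j" using staircase_cell[OF st] by simp_all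
  then show "i \<le> ns m" using ns_mono[of j m] by simp
qed

text \<open>The columns up to \<open>q\<close> lie inside the first \<open>p\<close> rows, so their
  cells are counted on both sides; what remains are the arcs opened within the first
  \<open>p\<close> rows and closed after column \<open>q\<close>.\<close>

lemma row_count_split:
  assumes "W = U \<or> W = V" "\<And>j. 1 \<le> j \<Longrightarrow> j \<le> q \<Longrightarrow> ns j \<le> p"
  shows "card {s \<in> W. fst s \<le> p} =
    card {s \<in> W. snd s \<le> q} + card {s \<in> W. fst s \<le> p \<and> q < snd s}"
proof -
  have "{s \<in> W. fst s \<le> p} = {s \<in> W. snd s \<le> q} \<union> {s \<in> W. fst s \<le> p \<and> q < snd s}"
  proof (intro equalityI subsetI)
    fix s assume s: "s \<in> {s \<in> W. snd s \<le> q} \<union> {s \<in> W. fst s \<le> p \<and> q < snd s}"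
    obtain i j where ij: "s = (i, j)" by (cases s)
    show "s \<in> {s \<in> W. fst s \<le> p}"
    proof (cases "j \<le> q")
      case True
      then show ?thesis using s assms(1) cells[of i j] assms(2)[of j] ij by fastforce
    qed (use s ij in auto)
  qed auto
  moreover have "finite W" using assms(1) finite_up_sets by auto
  ultimately show ?thesis by (simp add: card_Un_disjoint disjoint_iff)
qed

lemma count_Suc:
  assumes "W = U \<or> W = V"
  shows "card {s \<in> W. f s \<le> Suc q} = card {s \<in> W. f s \<le> q} + card {s \<in> W. f s = Suc q}"
proof -
  have "{s \<in> W. f s \<le> Suc q} = {s \<in> W. f s \<le> q} \<union> {s \<in> W. f s = Suc q}" by auto
  moreover have "finite W" using assms(1) finite_up_sets by auto
  ultimately show ?thesis by (simp add: card_Un_disjoint disjoint_iff)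
qed

text \<open>A first failure at column \<open>Suc q\<close> makes more arcs of \<open>U\<close> than
  of \<open>V\<close> span that point. Such an arc of \<open>U\<close> encloses every arc of
  \<open>V\<close> closing at \<open>Suc q\<close>, so closure puts the latter into
  \<open>U\<close>, and the failure was already present at \<open>q\<close>.\<close>

lemma row_dominance_imp_column_dominance:
  assumes rows: "\<And>p. card {s \<in> V. fst s \<le> p} \<le> card {s \<in> U. fst s \<le> p}"
  shows "card {s \<in> V. snd s \<le> q} \<le> card {s \<in> U. snd s \<le> q}"
proof (induction q)
  case 0
  have "{s \<in> V. snd s \<le> 0} = {}" using cells by fastforce
  then show ?case by (metis card.empty le0)
next
  case (Suc q)
  show ?case
  proof (rule ccontr)
    assume neg: "\<not> ?case"
    have "Suc q \<le> m"
    proof (rule ccontr)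
      assume "\<not> Suc q \<le> m"
      then have "{s \<in> V. snd s = Suc q} = {}" using cells by fastforce
      then have "card {s \<in> V. snd s \<le> Suc q} = card {s \<in> V. snd s \<le> q}"
        using count_Suc[of V snd q] by (simp del: Collect_empty_eq)
      then show False using neg Suc.IH count_Suc[of U snd q] by simp
    qed
    \<comment> \<open>The word is cut right after column \<open>Suc q\<close> closes: the openings
      before this point are those of the first \<open>ns (Suc q)\<close> rows.\<close>
    let ?p = "ns (Suc q)"
    let ?span = "\<lambda>W. {s \<in> W. fst s \<le> ?p \<and> Suc q < snd s}"
    have le_p: "ns j \<le> ?p" if "1 \<le> j" "j \<le> Suc q" for j
      using ns_mono[OF that \<open>Suc q \<le> m\<close>] .
    have "card (?span V) < card (?span U)"
      using neg rows[of ?p] row_count_split[of U "Suc q" ?p] row_count_split[of V "Suc q" ?p] le_p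
      by simp
    then obtain l r where c: "(l, r) \<in> U" "l \<le> ?p" "Suc q < r"
      by (cases "?span U = {}") auto
    have "{s \<in> V. snd s = Suc q} \<subseteq> {s \<in> U. snd s = Suc q}"
    proof clarsimp
      fix i assume "(i, Suc q) \<in> V"
      then have st: "(i, Suc q) \<in> staircase ns m" using cells by blast
      then have "l \<le> i" using staircase_noncrossing c cells[of l r] by blast
      then show "(i, Suc q) \<in> U" using U_up[OF c(1) st] c(3) by (simp add: cell_less_def cell_le_def)
    qed
    then have "card {s \<in> V. snd s = Suc q} \<le> card {s \<in> U. snd s = Suc q}"
      using finite_up_sets by (simp add: card_mono)
    then show False using neg Suc.IH count_Suc[of V snd q] count_Suc[of U snd q] by simp
  qed
qed

text \<open>Failure now travels to the right: a spanning arc of \<open>V\<close> encloses every arc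
  of \<open>U\<close> opening at row \<open>Suc p\<close>, so the comparison also fails at
  \<open>Suc p\<close>. At \<open>ns m\<close> all arcs are counted and equal cardinality excludes a
  failure; hence the descending induction.\<close>

lemma column_dominance_imp_row_dominance:
  assumes columns: "\<And>q. card {s \<in> V. snd s \<le> q} \<le> card {s \<in> U. snd s \<le> q}"
    and "card U = card V"
  shows "card {s \<in> V. fst s \<le> p} \<le> card {s \<in> U. fst s \<le> p}"
proof (induction "ns m - p" arbitrary: p rule: less_induct)
  case less
  show ?case
  proof (cases "ns m \<le> p")
    case True
    then have "{s \<in> V. fst s \<le> p} = V" "{s \<in> U. fst s \<le> p} = U" using cells by fastforce+
    then show ?thesis using assms(2) by simp
  next
    case False
    show ?thesis
    proof (rule ccontr)
      assume neg: "\<not> ?thesis"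
      \<comment> \<open>The columns closing before row \<open>Suc p\<close> opens are
        \<open>1, ..., q\<close>. The alternative \<open>m <= j\<close> stops the search at
        \<open>m\<close>; \<open>Suc j\<close> is the next column after \<open>j\<close> closed
        ones.\<close>
      define q where "q = (LEAST j. m \<le> j \<or> p < ns (Suc j))"
      let ?span = "\<lambda>W. {s \<in> W. fst s \<le> p \<and> q < snd s}"
      have "m \<le> q \<or> p < ns (Suc q)"
        unfolding q_def by (rule LeastI[of _ m]) simp
      then have above: "p < ns r" if "q < r" "r \<le> m" for r
        using that ns_mono[of "Suc q" r] by auto
      have below: "ns j \<le> p" if "1 \<le> j" "j \<le> q" for j
        using not_less_Least[of "j - 1" "\<lambda>j. m \<le> j \<or> p < ns (Suc j)"] that
        by (cases j) (simp_all flip: q_def)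
      have "card (?span U) < card (?span V)"
        using neg columns[of q] row_count_split[of U q p] row_count_split[of V q p] below by simp
      then obtain l r where c: "(l, r) \<in> V" "l \<le> p" "q < r"
        by (cases "?span V = {}") auto
      have "p < ns r" using above c cells[of l r] by simp
      have "{s \<in> U. fst s = Suc p} \<subseteq> {s \<in> V. fst s = Suc p}"
      proof clarsimp
        fix j assume "(Suc p, j) \<in> U"
        then have st: "(Suc p, j) \<in> staircase ns m" using cells by blast
        \<comment> \<open>Noncrossing is applied with the roles exchanged: \<open>r < j\<close>
          would force \<open>Suc p <= l\<close>, against \<open>l <= p\<close>.\<close>
        have "j \<le> r"
          using staircase_noncrossing[of l r ns m "Suc p" j] st c cells[of l r] \<open>p < ns r\<close>
          by fastforce
        then show "(Suc p, j) \<in> V"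
          using V_up[OF c(1) st] c by (simp add: cell_less_def cell_le_def)
      qed
      then have "card {s \<in> U. fst s = Suc p} \<le> card {s \<in> V. fst s = Suc p}"
        using finite_up_sets by (simp add: card_mono)
      moreover have "card {s \<in> V. fst s \<le> Suc p} \<le> card {s \<in> U. fst s \<le> Suc p}"
        using less.hyps[of "Suc p"] False by simp
      ultimately show False using neg count_Suc[of V fst p] count_Suc[of U fst p] by simp
    qed
  qed
qed

lemma row_dominance_iff_column_dominance:
  assumes "card U = card V"
  shows "(\<forall>p. card {s \<in> V. fst s \<le> p} \<le> card {s \<in> U. fst s \<le> p}) \<longleftrightarrow>
    (\<forall>q. card {s \<in> V. snd s \<le> q} \<le> card {s \<in> U. snd s \<le> q})"
  using row_dominance_imp_column_dominance column_dominance_imp_row_dominance assms by blast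

end

section \<open>Line sums of arrays\<close>

text \<open>Used on cells, to pass from the diagram to the staircase, and on line indices, to
  discard lines without a staircase cell.\<close>

lemma filter_nonzero_image_mset_subset:
  assumes "finite T" "S \<subseteq> T" "\<And>x. x \<in> T - S \<Longrightarrow> f x = 0"
  shows "filter_mset (\<lambda>x. x \<noteq> 0) (image_mset f (mset_set T)) =
    filter_mset (\<lambda>x. x \<noteq> 0) (image_mset f (mset_set S))"
proof -
  have "mset_set T = mset_set S + mset_set (T - S)"
    using mset_set_Union[of S "T - S"] assms(1,2) finite_subset
    by (metis Diff_disjoint Diff_partition finite_Diff)
  moreover have "filter_mset (\<lambda>x. x \<noteq> 0) (image_mset f (mset_set (T - S))) = {#}"
    using assms(1,3) by (auto simp: filter_mset_eq_conv)
  ultimately show ?thesis by simp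
qed

text \<open>Treats rows and columns at once: \<open>\<pi>\<close> is \<open>fst\<close> or
  \<open>snd\<close>, and \<open>f\<close> gives the line sums. Each line meets the staircase at
  most once, so a sum is a single entry or zero.\<close>

locale line_sums =
  fixes S :: "'a set" and \<pi> :: "'a \<Rightarrow> nat" and k :: nat and f :: "nat \<Rightarrow> int" and A :: "'a \<Rightarrow> nat"
  assumes finite_S: "finite S" and inj: "inj_on \<pi> S" and range: "\<pi> ` S \<subseteq> {1..k}"
    and on_S: "\<And>s. s \<in> S \<Longrightarrow> f (\<pi> s) = int (A s)"
    and off_S: "\<And>i. i \<notin> \<pi> ` S \<Longrightarrow> f i = 0"
begin

lemma filter_nonzero_mset:
  "filter_mset (\<lambda>x. x \<noteq> 0) (mset (map f [1..<Suc k])) =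
    image_mset int (filter_mset (\<lambda>x. x \<noteq> 0) (image_mset A (mset_set S)))"
proof -
  have "mset (map f [1..<Suc k]) = image_mset f (mset_set {1..k})"
    by (simp add: atLeastLessThanSuc_atLeastAtMost del: upt_Suc)
  then have "filter_mset (\<lambda>x. x \<noteq> 0) (mset (map f [1..<Suc k])) =
      filter_mset (\<lambda>x. x \<noteq> 0) (image_mset f (mset_set (\<pi> ` S)))"
    using filter_nonzero_image_mset_subset[of "{1..k}" "\<pi> ` S" f] range off_S by simp
  also have "image_mset f (mset_set (\<pi> ` S)) = image_mset (\<lambda>s. f (\<pi> s)) (mset_set S)"
    using inj by (simp add: image_mset_mset_set[symmetric] multiset.map_comp comp_def)
  also have "\<dots> = image_mset int (image_mset A (mset_set S))"
    by (auto intro!: image_mset_cong simp: multiset.map_comp comp_def on_S finite_S)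
  finally show ?thesis by (simp add: filter_mset_image_mset)
qed

text \<open>Since \<open>v > 0\<close>, a counted line contains a cell of \<open>S\<close>, and
  injectivity makes it unique; so counting positions becomes counting cells.\<close>

lemma count_ge_take:
  assumes "0 < v"
  shows "count_ge v (take p (map f [1..<Suc k])) = card {s \<in> S. v \<le> int (A s) \<and> \<pi> s \<le> p}"
proof -
  \<comment> \<open>\<open>p\<close> may exceed the length; the bound \<open>\<pi> s <= k\<close>
    turns \<open>min p k\<close> back into \<open>p\<close> on passing to cells.\<close>
  have "take p [1..<Suc k] = [1..<Suc (min p k)]"
    by (simp add: take_upt min_def del: upt_Suc)
  then have "count_ge v (take p (map f [1..<Suc k])) =
      length (filter (\<lambda>i. v \<le> f i) [1..<Suc (min p k)])"
    by (simp add: count_ge_def take_map filter_map comp_def del: upt_Suc)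
  also have "\<dots> = card {i \<in> {1..min p k}. v \<le> f i}"
    by (subst distinct_length_filter)
       (auto intro!: arg_cong[of _ _ card] simp del: upt_Suc)
  also have "{i \<in> {1..min p k}. v \<le> f i} = \<pi> ` {s \<in> S. v \<le> int (A s) \<and> \<pi> s \<le> p}"
  proof (intro equalityI subsetI)
    fix i assume i: "i \<in> {i \<in> {1..min p k}. v \<le> f i}"
    then have "f i \<noteq> 0" using assms by auto
    then obtain s where "s \<in> S" "i = \<pi> s" using off_S by blast
    then show "i \<in> \<pi> ` {s \<in> S. v \<le> int (A s) \<and> \<pi> s \<le> p}"
      using i on_S by auto
  qed (use on_S range in auto)
  also have "card \<dots> = card {s \<in> S. v \<le> int (A s) \<and> \<pi> s \<le> p}"
    by (rule card_image) (rule inj_on_subset[OF inj], auto)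
  finally show ?thesis .
qed

lemma in_sym_orbit:
  assumes "filter_mset (\<lambda>x. x \<noteq> 0) (image_mset A (mset_set S)) = mset lam" "0 \<notin> set lam"
  shows "map f [1..<Suc k] \<in> sym_orbit k lam"
  using in_sym_orbitI[of "map f [1..<Suc k]" k lam] filter_nonzero_mset assms by simp

lemma card_le: "card S \<le> k"
  using card_inj_on_le[OF inj range] by simp

end

lemma line_sum:
  assumes "finite D" "S \<subseteq> D" "inj_on \<pi> S" "\<And>s. s \<notin> S \<Longrightarrow> A s = 0"
  shows "s \<in> S \<Longrightarrow> (\<Sum>t | t \<in> D \<and> \<pi> t = \<pi> s. int (A t)) = int (A s)"
    and "i \<notin> \<pi> ` S \<Longrightarrow> (\<Sum>t | t \<in> D \<and> \<pi> t = i. int (A t)) = 0"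
proof -
  assume s: "s \<in> S"
  have "(\<Sum>t | t \<in> D \<and> \<pi> t = \<pi> s. int (A t)) = (\<Sum>t\<in>{s}. int (A t))"
    by (rule sum.mono_neutral_right) (use assms s in \<open>auto simp: inj_on_def\<close>)
  then show "(\<Sum>t | t \<in> D \<and> \<pi> t = \<pi> s. int (A t)) = int (A s)" by simp
next
  assume "i \<notin> \<pi> ` S"
  then show "(\<Sum>t | t \<in> D \<and> \<pi> t = i. int (A t)) = 0"
    using assms(4) by (intro sum.neutral) auto
qed

text \<open>Indexing the sums by cells makes \<open>hor\<close> and \<open>vrt\<close> two instances
  of one formula that differ in the projection.\<close>

lemma hor_eq:
  "hor ns m A = map (\<lambda>i. \<Sum>t | t \<in> diagram ns m \<and> fst t = i. int (A t)) [1..<Suc (ns m)]"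
  unfolding hor_def
proof (rule map_cong[OF refl])
  fix i
  show "(\<Sum>j | (i, j) \<in> diagram ns m. int (A (i, j))) =
      (\<Sum>t | t \<in> diagram ns m \<and> fst t = i. int (A t))"
    by (rule sum.reindex_bij_witness[of _ snd "Pair i"]) auto
qed

lemma vrt_eq:
  "vrt ns m A = map (\<lambda>j. \<Sum>t | t \<in> diagram ns m \<and> snd t = j. int (A t)) [1..<Suc m]"
  unfolding vrt_def
proof (rule map_cong[OF refl])
  fix j
  show "(\<Sum>i | (i, j) \<in> diagram ns m. int (A (i, j))) =
      (\<Sum>t | t \<in> diagram ns m \<and> snd t = j. int (A t))"
    by (rule sum.reindex_bij_witness[of _ fst "\<lambda>i. (i, j)"]) auto
qed

lemma filter_nonzero_staircase:
  assumes "A \<in> DL ns m lam"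
  shows "filter_mset (\<lambda>x. x \<noteq> 0) (image_mset A (mset_set (staircase ns m))) = mset lam"
  using assms filter_nonzero_image_mset_subset
      [OF finite_diagram staircase_subset_diagram, where f = A and ns1 = ns and m1 = m]
  by (auto simp: DL_def)

lemma line_sums_staircase:
  assumes "A \<in> DL ns m lam" "inj_on \<pi> (staircase ns m)" "\<pi> ` staircase ns m \<subseteq> {1..k}"
  shows "line_sums (staircase ns m) \<pi> k
    (\<lambda>i. \<Sum>t | t \<in> diagram ns m \<and> \<pi> t = i. int (A t)) A"
proof (rule line_sums.intro[OF finite_staircase assms(2,3)])
  have zero: "A s = 0" if "s \<notin> staircase ns m" for s
    using assms(1) that unfolding DL_def by blast
  note line_sum = line_sum[OF finite_diagram staircase_subset_diagram assms(2)]
  show "(\<Sum>t | t \<in> diagram ns m \<and> \<pi> t = \<pi> s. int (A t)) = int (A s)"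
    if "s \<in> staircase ns m" for s
    by (rule line_sum(1)) (use that zero in simp_all)
  show "(\<Sum>t | t \<in> diagram ns m \<and> \<pi> t = i. int (A t)) = 0"
    if "i \<notin> \<pi> ` staircase ns m" for i
    by (rule line_sum(2)) (use that zero in simp_all)
qed

lemma fst_staircase_subset:
  assumes "\<And>i j. 1 \<le> i \<Longrightarrow> i \<le> j \<Longrightarrow> j \<le> m \<Longrightarrow> ns i \<le> ns j"
  shows "fst ` staircase ns m \<subseteq> {1..ns m}"
proof clarify
  fix i j assume "(i, j) \<in> staircase ns m"
  then have "1 \<le> j" "j \<le> m" "1 \<le> i" "i \<le> ns j" using staircase_cell by blast+
  then show "fst (i, j) \<in> {1..ns m}" using assms[of j m] by simp
qed

lemma snd_staircase_subset: "snd ` staircase ns m \<subseteq> {1..m}"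
proof clarify
  fix i j assume "(i, j) \<in> staircase ns m"
  then have "1 \<le> j" "j \<le> m" using staircase_cell by blast+
  then show "snd (i, j) \<in> {1..m}" by simp
qed

text \<open>The size depends on \<open>lam\<close> and \<open>v\<close> alone; hence the sets of
  \<open>A\<close> and \<open>B\<close> are equally large, which the passage from columns to rows
  requires.\<close>

lemma card_superlevel:
  assumes "A \<in> DL ns m lam" "0 < v"
  shows "card {s \<in> staircase ns m. v \<le> int (A s)} = size (filter_mset (\<lambda>x. v \<le> int x) (mset lam))"
proof -
  have "(\<lambda>x. x \<noteq> 0 \<and> v \<le> int x) = (\<lambda>x. v \<le> int x)" using assms(2) by auto
  then have "filter_mset (\<lambda>x. v \<le> int x) (mset lam) =
      filter_mset (\<lambda>x. v \<le> int x) (image_mset A (mset_set (staircase ns m)))"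
    unfolding filter_nonzero_staircase[OF assms(1), symmetric] filter_filter_mset by simp
  then show ?thesis
    by (simp add: filter_mset_image_mset filter_mset_mset_set finite_staircase)
qed

section \<open>Reduction to positive thresholds\<close>

lemma count_ge_nonpos:
  assumes "v \<le> 0" "\<forall>x\<in>set xs. 0 \<le> x"
  shows "count_ge v xs = length xs"
  unfolding count_ge_def using assms by (subst filter_True) auto

text \<open>For nonnegative vectors a nonpositive threshold counts all entries, and equal lengths
  give equal prefix counts.\<close>

lemma prefix_dominates_iff_pos:
  assumes "length a = length b" "\<forall>x\<in>set a. 0 \<le> x" "\<forall>x\<in>set b. 0 \<le> x"
  shows "prefix_dominates a b \<longleftrightarrow>
    (\<forall>v>0. \<forall>p. count_ge v (take p b) \<le> count_ge v (take p a))"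
proof -
  have "count_ge v (take p b) \<le> count_ge v (take p a)" if "v \<le> 0" for v p
    using that assms by (subst (1 2) count_ge_nonpos) (auto dest: in_set_takeD)
  then show ?thesis unfolding prefix_dominates_def by (meson not_le)
qed

theorem corollary4p26:
  fixes m n :: nat and ns :: "nat \<Rightarrow> nat" and lam :: "nat list"
    and A B :: "nat \<times> nat \<Rightarrow> nat"
  assumes "1 \<le> m"
    and "0 < ns 1"
    and "\<And>i j. 1 \<le> i \<Longrightarrow> i \<le> j \<Longrightarrow> j \<le> m \<Longrightarrow> ns i \<le> ns j"
    and "n = ns m"
    and "is_partition lam"
    and "length lam \<le> card (staircase ns m)"
    and "A \<in> DL ns m lam"
    and "B \<in> DL ns m lam"
  shows "bruhat n lam (hor ns m A) (hor ns m B) \<longleftrightarrow> bruhat m lam (vrt ns m A) (vrt ns m B)"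
proof -
  let ?St = "staircase ns m"
  note rows = inj_on_fst_staircase fst_staircase_subset[of m ns, OF assms(3)]
  note columns = inj_on_snd_staircase snd_staircase_subset
  interpret hA: line_sums ?St fst "ns m" "\<lambda>i. \<Sum>t | t \<in> diagram ns m \<and> fst t = i. int (A t)" A
    by (rule line_sums_staircase[OF assms(7) rows])
  interpret hB: line_sums ?St fst "ns m" "\<lambda>i. \<Sum>t | t \<in> diagram ns m \<and> fst t = i. int (B t)" B
    by (rule line_sums_staircase[OF assms(8) rows])
  interpret vA: line_sums ?St snd m "\<lambda>i. \<Sum>t | t \<in> diagram ns m \<and> snd t = i. int (A t)" A
    by (rule line_sums_staircase[OF assms(7) columns])
  interpret vB: line_sums ?St snd m "\<lambda>i. \<Sum>t | t \<in> diagram ns m \<and> snd t = i. int (B t)" B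
    by (rule line_sums_staircase[OF assms(8) columns])
  have "0 \<notin> set lam" using assms(5) by (simp add: is_partition_def)
  have hor_pos: "prefix_dominates (hor ns m A) (hor ns m B) \<longleftrightarrow>
      (\<forall>v>0. \<forall>p. count_ge v (take p (hor ns m B)) \<le> count_ge v (take p (hor ns m A)))"
    by (rule prefix_dominates_iff_pos) (auto simp: hor_eq sum_nonneg simp del: upt_Suc)
  have vrt_pos: "prefix_dominates (vrt ns m A) (vrt ns m B) \<longleftrightarrow>
      (\<forall>v>0. \<forall>p. count_ge v (take p (vrt ns m B)) \<le> count_ge v (take p (vrt ns m A)))"
    by (rule prefix_dominates_iff_pos) (auto simp: vrt_eq sum_nonneg simp del: upt_Suc)
  have "bruhat n lam (hor ns m A) (hor ns m B) \<longleftrightarrow> prefix_dominates (hor ns m A) (hor ns m B)"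
    unfolding hor_eq assms(4)
    by (rule bruhat_iff_prefix_dominates
        [OF hA.in_sym_orbit[OF filter_nonzero_staircase[OF assms(7)] \<open>0 \<notin> set lam\<close>]
          hB.in_sym_orbit[OF filter_nonzero_staircase[OF assms(8)] \<open>0 \<notin> set lam\<close>]
          order_trans[OF assms(6) hA.card_le]])
  also have "\<dots> \<longleftrightarrow> (\<forall>v>0. \<forall>p. card {s \<in> ?St. v \<le> int (B s) \<and> fst s \<le> p}
      \<le> card {s \<in> ?St. v \<le> int (A s) \<and> fst s \<le> p})"
    unfolding hor_pos unfolding hor_eq
    by (simp only: hA.count_ge_take hB.count_ge_take cong: imp_cong)
  also have "\<dots> \<longleftrightarrow> (\<forall>v>0. \<forall>p. card {s \<in> ?St. v \<le> int (B s) \<and> snd s \<le> p}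
      \<le> card {s \<in> ?St. v \<le> int (A s) \<and> snd s \<le> p})"
  \<comment> \<open>The comparison of rows and columns holds for each threshold \<open>v\<close>
    separately.\<close>
  proof (rule all_cong1, rule imp_cong[OF refl])
    fix v :: int assume "0 < v"
    have up: "t \<in> {s \<in> ?St. v \<le> int (C s)}"
      if "C \<in> DL ns m lam" "s \<in> {s \<in> ?St. v \<le> int (C s)}" "t \<in> ?St" "cell_less s t" for C s t
    proof -
      have "C s \<le> C t" using that by (simp add: DL_def)
      then show ?thesis using that by simp
    qed
    \<comment> \<open>The array on the smaller side of the order supplies \<open>U\<close>, whose
      prefix counts have to be the larger ones.\<close>
    interpret staircase_up_sets ns m "{s \<in> ?St. v \<le> int (A s)}" "{s \<in> ?St. v \<le> int (B s)}"
      by (rule staircase_up_sets.intro[OF assms(3) _ _ up[OF assms(7)] up[OF assms(8)]]) auto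
    show "(\<forall>p. card {s \<in> ?St. v \<le> int (B s) \<and> fst s \<le> p}
          \<le> card {s \<in> ?St. v \<le> int (A s) \<and> fst s \<le> p}) \<longleftrightarrow>
        (\<forall>p. card {s \<in> ?St. v \<le> int (B s) \<and> snd s \<le> p}
          \<le> card {s \<in> ?St. v \<le> int (A s) \<and> snd s \<le> p})"
      using row_dominance_iff_column_dominance card_superlevel[OF assms(7) \<open>0 < v\<close>]
        card_superlevel[OF assms(8) \<open>0 < v\<close>]
      by (simp add: conj_assoc)
  qed
  also have "\<dots> \<longleftrightarrow> prefix_dominates (vrt ns m A) (vrt ns m B)"
    unfolding vrt_pos unfolding vrt_eq
    by (simp only: vA.count_ge_take vB.count_ge_take cong: imp_cong)
  also have "\<dots> \<longleftrightarrow> bruhat m lam (vrt ns m A) (vrt ns m B)"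
    unfolding vrt_eq
    by (rule bruhat_iff_prefix_dominates
        [OF vA.in_sym_orbit[OF filter_nonzero_staircase[OF assms(7)] \<open>0 \<notin> set lam\<close>]
          vB.in_sym_orbit[OF filter_nonzero_staircase[OF assms(8)] \<open>0 \<notin> set lam\<close>]
          order_trans[OF assms(6) vA.card_le], symmetric])
  finally show ?thesis .
qed

end
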